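(* For every weight $w$ on $\mathbb{R}^n$, $$ind\{K(\cdot,w\chi_Q;L^1(Q),L^\infty(Q))\}_Q>0\iff\widetilde{ind}(w)<1.$$
   Context: A weight is a positive locally integrable function on $\mathbb{R}^n$. All cubes $Q\subset\mathbb{R}^n$ have sides parallel to the coordinate axes; $f^*$ denotes the nonincreasing rearrangement of $f$. For $0<s<|Q|$, $K(s,w\chi_Q;L^1(Q),L^\infty(Q))=\int_0^s(w\chi_Q)^*(u)\,du=:\phi_{w,Q}(s)$ (Peetre $K$-functional). A non-negative function $\phi$ on an interval $(0,l)$ is almost increasing (a.i.) if there is $C\ge1$ (the constant of almost increase) with $\phi(s)\le C\phi(t)$ for all $s\le t$ in $(0,l)$. Then $$ind\{\phi_{w,Q}\}_Q=\sup\{\delta\ge0:\exists\gamma\in(0,1)\text{ such that for all cubes }Q,\ \phi_{w,Q}(s)s^{-\delta}\text{ is a.i. on }(0,\gamma|Q|)\text{ with constant of a.i. independent of }Q\}.$$ $\widetilde{ind}(w)$ is the infimum of all $\lambda>0$ for which there exist $r\in(0,1)$ and $\widetilde\gamma>0$ such that for all cubes $Q$ and all $0<s\le t<r|Q|$, $$\frac{(w\chi_Q)^*(s)}{(w\chi_Q)^*(t)}\le\widetilde\gamma\left(\frac st\right)^{-\lambda},$$ with $\inf\emptyset=+\infty$. *)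

theory Defs
  imports "HOL-Analysis.Analysis" "HOL-Probability.Essential_Supremum"
begin

text \<open>Weights are functions modulo null sets, so positivity is required almost everywhere.\<close>

definition is_weight :: "(real ^ 'n \<Rightarrow> real) \<Rightarrow> bool" where
  "is_weight w \<longleftrightarrow>
     (\<forall>K. compact K \<longrightarrow> w absolutely_integrable_on K) \<and> (AE x in lebesgue. 0 < w x)"

definition cubes :: "(real ^ 'n) set set" where
  "cubes = {cbox a (\<chi> i. a $ i + l) | a l. 0 < l}"

definition restr :: "(real ^ 'n \<Rightarrow> real) \<Rightarrow> (real ^ 'n) set \<Rightarrow> real ^ 'n \<Rightarrow> real" where
  "restr w Q = (\<lambda>x. w x * indicat_real Q x)"

text \<open>The set in the following definition is nonempty whenever \<open>f\<close> is integrable and \<open>t > 0\<close>;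
  values at other arguments play no role.\<close>

definition rearrangement :: "(real ^ 'n \<Rightarrow> real) \<Rightarrow> real \<Rightarrow> real" where
  "rearrangement f t = Inf {y. 0 \<le> y \<and> emeasure lebesgue {x. y < \<bar>f x\<bar>} \<le> ennreal t}"

definition L1 :: "(real ^ 'n) set \<Rightarrow> (real ^ 'n \<Rightarrow> real) set" where
  "L1 Q = {g. integrable (lebesgue_on Q) g}"

definition L1_norm :: "(real ^ 'n) set \<Rightarrow> (real ^ 'n \<Rightarrow> real) \<Rightarrow> real" where
  "L1_norm Q g = (\<integral>x. \<bar>g x\<bar> \<partial>lebesgue_on Q)"

definition Linf :: "(real ^ 'n) set \<Rightarrow> (real ^ 'n \<Rightarrow> real) set" where
  "Linf Q = {h \<in> borel_measurable (lebesgue_on Q).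
               esssup (lebesgue_on Q) (\<lambda>x. ereal \<bar>h x\<bar>) < \<infinity>}"

definition Linf_norm :: "(real ^ 'n) set \<Rightarrow> (real ^ 'n \<Rightarrow> real) \<Rightarrow> real" where
  "Linf_norm Q h = real_of_ereal (esssup (lebesgue_on Q) (\<lambda>x. ereal \<bar>h x\<bar>))"

text \<open>The Peetre functional \<open>K(s, f; L1(Q), L\<infinity>(Q))\<close>. For \<open>0 < s < |Q|\<close> and \<open>f\<close> integrable and
  supported in \<open>Q\<close>, it is the integral of \<open>rearrangement f\<close> over \<open>(0, s)\<close>.\<close>

definition K_functional :: "real \<Rightarrow> (real ^ 'n \<Rightarrow> real) \<Rightarrow> (real ^ 'n) set \<Rightarrow> real" where
  "K_functional s f Q =
     Inf {L1_norm Q g + s * Linf_norm Q h | g h.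
            g \<in> L1 Q \<and> h \<in> Linf Q \<and> (AE x in lebesgue_on Q. f x = g x + h x)}"

definition almost_increasing :: "real \<Rightarrow> real \<Rightarrow> (real \<Rightarrow> real) \<Rightarrow> bool" where
  "almost_increasing C l \<phi> \<longleftrightarrow>
     1 \<le> C \<and> (\<forall>s\<in>{0<..<l}. 0 \<le> \<phi> s) \<and>
     (\<forall>s\<in>{0<..<l}. \<forall>t\<in>{0<..<l}. s \<le> t \<longrightarrow> \<phi> s \<le> C * \<phi> t)"

definition ind :: "((real ^ 'n) set \<Rightarrow> real \<Rightarrow> real) \<Rightarrow> ereal" where
  "ind \<phi> = Sup (ereal ` {\<delta>. 0 \<le> \<delta> \<and>
     (\<exists>\<gamma>\<in>{0<..<1}. \<exists>C. \<forall>Q\<in>cubes.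
        almost_increasing C (\<gamma> * measure lebesgue Q) (\<lambda>s. \<phi> Q s * s powr (- \<delta>)))})"

text \<open>The denominator below is positive for a weight \<open>w\<close>, since \<open>t < |Q|\<close>.\<close>

definition ind_tilde :: "(real ^ 'n \<Rightarrow> real) \<Rightarrow> ereal" where
  "ind_tilde w = Inf (ereal ` {p. 0 < p \<and>
     (\<exists>r\<in>{0<..<1}. \<exists>c>0. \<forall>Q\<in>cubes. \<forall>s t.
        0 < s \<and> s \<le> t \<and> t < r * measure lebesgue Q \<longrightarrow>
        rearrangement (restr w Q) s / rearrangement (restr w Q) t \<le> c * (s / t) powr (- p))})"

end

theory Submission
  imports Defs
begin

text \<open>
  Fix a cube \<open>Q\<close> and put \<open>f = w \<chi>\<^sub>Q\<close>, \<open>F = f\<^sup>*\<close> and \<open>K(s) = K(s, f; L\<^sup>1(Q), L\<^sup>\<infinity>(Q))\<close>. Both index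
  conditions turn out to be equivalent on each cube separately, with constants that depend only on the
  constants of the other condition; so uniformity over all cubes is inherited.

  The function \<open>K\<close> is analysed through truncations of \<open>f\<close>. With the excess
  \<open>\<psi>(y) = \<integral> (|f| - y)\<^sub>+\<close>, cutting \<open>f\<close> at height \<open>y\<close> is the best decomposition whose bounded part has norm
  at most \<open>y\<close>, so \<open>K(s)\<close> is the minimum of \<open>\<psi>(y) + s y\<close> over \<open>y \<ge> 0\<close>. The slope of \<open>\<psi>\<close> at \<open>y\<close> is
  \<open>- |{|f| > y}|\<close>, so the minimum is attained at \<open>y = F(s)\<close>:
  \<open>K(s) = \<psi>(F(s)) + s F(s)\<close> (\<open>K_functional_eq_rearrangement\<close>). Two inequalities follow,
  \<open>s F(s) \<le> K(s)\<close> and \<open>K(t) \<le> K(u) + t F(u)\<close>, and they carry both implications.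

  \<^item> If \<open>K(s) s\<^bsup>-\<delta>\<^esup>\<close> is almost increasing, then for a small fixed \<open>\<kappa>\<close> one has \<open>K(t) \<le> K(t/\<kappa>) / 2\<close>. Since
    \<open>K(t/\<kappa>) \<le> K(t) + (t/\<kappa>) F(t)\<close>, this gives \<open>K(t) \<le> (t/\<kappa>) F(t)\<close>: up to a constant \<open>F(t)\<close> is \<open>K(t)/t\<close>, and
    the growth bound on \<open>K\<close> becomes a power bound on \<open>F\<close> with exponent \<open>1 - \<delta> < 1\<close>
    (\<open>F_power_bound_if_K_growth\<close>).

  \<^item> If \<open>F\<close> has a power bound with exponent \<open>p < 1\<close>, then summing \<open>K(u) \<le> K(u/2) + u F(u/2)\<close> over
    \<open>u = s, s/2, s/4, ...\<close> gives a geometric series with ratio \<open>2\<^bsup>p-1\<^esup> < 1\<close>, hence \<open>K(s) \<le> B s F(s)\<close>, and the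
    power bound on \<open>F\<close> makes \<open>K(s) s\<^bsup>p-1\<^esup>\<close> almost increasing (\<open>K_growth_if_F_power_bound\<close>).
\<close>

section \<open>Power bounds for a minimum of affine functions and its minimiser\<close>

text \<open>
  This isolates what is needed about one cube: \<open>K u\<close> is the minimum over \<open>y \<ge> 0\<close> of the affine functions
  \<open>u \<mapsto> \<psi> y + u * y\<close>, attained at \<open>y = F u\<close>.
\<close>

locale truncation_pair =
  fixes K F \<psi> :: "real \<Rightarrow> real"
  assumes F_nonneg: "0 < u \<Longrightarrow> 0 \<le> F u"
    and \<psi>_nonneg: "0 \<le> \<psi> y"
    and \<psi>_tendsto_0: "(\<psi> \<longlongrightarrow> 0) at_top"
    and K_le: "0 < u \<Longrightarrow> 0 \<le> y \<Longrightarrow> K u \<le> \<psi> y + u * y"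
    and K_eq: "0 < u \<Longrightarrow> K u = \<psi> (F u) + u * F u"
begin

lemma K_ge: "0 < u \<Longrightarrow> u * F u \<le> K u"
  using K_eq \<psi>_nonneg[of "F u"] by simp

lemma K_nonneg: "0 < u \<Longrightarrow> 0 \<le> K u"
  using K_ge[of u] F_nonneg[of u] by (meson mult_nonneg_nonneg less_imp_le order_trans)

text \<open>The cut that is optimal for \<open>u\<close> is a competitor for \<open>t\<close>.\<close>

lemma K_le_K_plus:
  assumes "0 < u" "0 < t"
  shows "K t \<le> K u + t * F u"
proof -
  have "K t \<le> \<psi> (F u) + t * F u"
    using K_le F_nonneg assms by blast
  moreover have "\<psi> (F u) \<le> K u"
    using K_eq[OF assms(1)] F_nonneg[OF assms(1)] assms(1) by simp
  ultimately show ?thesis by simp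
qed

text \<open>
  The constant \<open>\<kappa>\<close> is so small that \<open>K\<close> at least doubles from \<open>t\<close> to \<open>t / \<kappa>\<close>. As \<open>F t\<close> controls the
  increase of \<open>K\<close> to the right of \<open>t\<close>, it then controls \<open>K t\<close> itself. The range of \<open>t\<close> shrinks by the
  factor \<open>\<kappa>\<close> because the growth bound is applied at \<open>t / \<kappa>\<close>.
\<close>

lemma F_power_bound_if_K_growth:
  assumes growth: "\<And>s t. \<lbrakk>0 < s; s \<le> t; t < L\<rbrakk> \<Longrightarrow> K s \<le> C * (s / t) powr \<delta> * K t"
    and \<kappa>: "C * \<kappa> powr \<delta> \<le> 1 / 2"
    and asm: "0 \<le> C" "0 < \<kappa>" "\<kappa> < 1" "0 < s" "s \<le> t" "t < \<kappa> * L"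
  shows "F s \<le> C / \<kappa> * (s / t) powr (\<delta> - 1) * F t"
proof -
  have t: "0 < t" using asm by simp
  define u where "u = t / \<kappa>"
  have u: "0 < u" "t \<le> u" "u < L" "t / u = \<kappa>"
    using t asm by (auto simp: u_def field_simps mult_le_cancel_left1)
  have "K t \<le> C * \<kappa> powr \<delta> * K u"
    using growth[of t u] t u by simp
  also have "\<dots> \<le> 1 / 2 * K u"
    using \<kappa> K_nonneg[OF u(1)] by (intro mult_right_mono) auto
  finally have "2 * K t \<le> K u" by simp
  with K_le_K_plus[OF t u(1)] have *: "K t \<le> u * F t" by simp
  have "s * F s \<le> K s" using K_ge asm by simp
  also have "\<dots> \<le> C * (s / t) powr \<delta> * K t"
  proof (rule growth)
    have "0 < \<kappa> * L" using t asm by linarith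
    then have "0 < L" using asm by (simp add: zero_less_mult_iff)
    then have "\<kappa> * L \<le> L" using asm by (simp add: mult_le_cancel_right1)
    then show "t < L" using asm by linarith
  qed (use asm in auto)
  also have "\<dots> \<le> C * (s / t) powr \<delta> * (u * F t)"
    using * asm by (intro mult_left_mono) auto
  also have "\<dots> = s * (C / \<kappa> * (s / t) powr (\<delta> - 1) * F t)"
    using t asm by (simp add: u_def powr_diff field_simps)
  finally show ?thesis using asm(4) by (rule mult_left_le_imp_le)
qed

text \<open>
  Dyadic summation towards \<open>0\<close>. The remainder \<open>K (s / 2 ^ n)\<close> is at most \<open>\<psi> y + s / 2 ^ n * y\<close> for every
  \<open>y\<close>, so it disappears when first \<open>n\<close> and then \<open>y\<close> tends to infinity.
\<close>

lemma K_le_F_if_F_power_bound: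
  assumes F: "\<And>s t. \<lbrakk>0 < s; s \<le> t; t < R\<rbrakk> \<Longrightarrow> F s \<le> c * (s / t) powr (- p) * F t"
    and asm: "0 \<le> c" "p < 1" "0 < s" "s < R"
  shows "K s \<le> c * 2 powr p / (1 - 2 powr (p - 1)) * (s * F s)"
proof -
  define q A where "q = (2::real) powr (p - 1)" and "A = c * 2 powr p * (s * F s)"
  have q: "0 < q" "q < 1" using asm by (auto simp: q_def powr_less_one)
  have A: "0 \<le> A" using asm F_nonneg by (simp add: A_def)
  have step: "K (s / 2 ^ n) \<le> K (s / 2 ^ Suc n) + A * q ^ n" for n
  proof -
    have "F (s / 2 ^ Suc n) \<le> c * ((s / 2 ^ Suc n) / s) powr (- p) * F s"
      by (rule F) (use asm in \<open>auto simp: divide_le_eq mult_le_cancel_left1 one_le_power simp flip: power_Suc\<close>)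
    also have "(s / 2 ^ Suc n) / s = 2 powr (- real (Suc n))"
      using asm by (simp add: powr_minus powr_realpow divide_inverse del: of_nat_Suc power_Suc)
    also have "(2 powr (- real (Suc n))) powr (- p) = 2 powr p * (2::real) powr (real n * p)"
      by (simp add: powr_powr powr_add[symmetric] algebra_simps)
    finally have "F (s / 2 ^ Suc n) \<le> c * (2 powr p * 2 powr (real n * p)) * F s" .
    then have "s / 2 ^ n * F (s / 2 ^ Suc n) \<le> s / 2 ^ n * (c * (2 powr p * 2 powr (real n * p)) * F s)"
      using asm by (intro mult_left_mono) auto
    also have "\<dots> = A * (2 powr (real n * p) / 2 ^ n)"
      by (simp add: A_def)
    also have "(2::real) powr (real n * p) / 2 ^ n = 2 powr (real n * (p - 1))"
      by (simp add: powr_realpow[symmetric] powr_diff[symmetric] algebra_simps)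
    also have "\<dots> = q ^ n"
      by (simp add: q_def powr_powr mult.commute flip: powr_realpow)
    finally show ?thesis
      using K_le_K_plus[of "s / 2 ^ Suc n" "s / 2 ^ n"] asm by simp
  qed
  have sum: "K s \<le> K (s / 2 ^ n) + A * (\<Sum>j<n. q ^ j)" for n
  proof (induction n)
    case (Suc n)
    then show ?case using step[of n] by (simp add: algebra_simps)
  qed simp
  have "K s \<le> \<psi> y + A / (1 - q)" if "0 \<le> y" for y
  proof (rule LIMSEQ_le_const)
    have "(\<lambda>n. \<psi> y + s * y * (1 / 2) ^ n + A * (1 / (1 - q)))
        \<longlonglongrightarrow> \<psi> y + s * y * 0 + A * (1 / (1 - q))"
      by (intro tendsto_intros LIMSEQ_power_zero) auto
    then show "(\<lambda>n. \<psi> y + s * y * (1 / 2) ^ n + A * (1 / (1 - q))) \<longlonglongrightarrow> \<psi> y + A / (1 - q)"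
      by simp
    have "K s \<le> \<psi> y + s * y * (1 / 2) ^ n + A * (1 / (1 - q))" for n
    proof -
      have "(\<Sum>j<n. q ^ j) = (1 - q ^ n) / (1 - q)"
        using q by (simp add: sum_gp_strict)
      also have "\<dots> \<le> 1 / (1 - q)" using q by (intro divide_right_mono) auto
      finally have "A * (\<Sum>j<n. q ^ j) \<le> A * (1 / (1 - q))"
        using A by (intro mult_left_mono)
      moreover have "K (s / 2 ^ n) \<le> \<psi> y + s * y * (1 / 2) ^ n"
        using K_le[of "s / 2 ^ n" y] asm that by (simp add: power_one_over)
      ultimately show ?thesis using sum[of n] by linarith
    qed
    then show "\<exists>N. \<forall>n\<ge>N. K s \<le> \<psi> y + s * y * (1 / 2) ^ n + A * (1 / (1 - q))" by blast
  qed
  then have "\<forall>\<^sub>F y in at_top. K s \<le> \<psi> y + A / (1 - q)"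
    by (auto intro: eventually_mono[OF eventually_ge_at_top[of 0]])
  moreover have "((\<lambda>y. \<psi> y + A / (1 - q)) \<longlongrightarrow> 0 + A / (1 - q)) at_top"
    by (intro tendsto_intros \<psi>_tendsto_0)
  ultimately have "K s \<le> 0 + A / (1 - q)"
    by (intro tendsto_lowerbound) auto
  then show ?thesis by (simp add: A_def q_def)
qed

text \<open>
  Up to constants \<open>K s\<close> is \<open>s * F s\<close>, and multiplication by \<open>s\<close> turns the decay exponent \<open>p\<close> of \<open>F\<close> into
  the growth exponent \<open>1 - p\<close> of \<open>K\<close>.
\<close>

lemma K_growth_if_F_power_bound:
  assumes F: "\<And>s t. \<lbrakk>0 < s; s \<le> t; t < R\<rbrakk> \<Longrightarrow> F s \<le> c * (s / t) powr (- p) * F t"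
    and asm: "0 \<le> c" "p < 1" "0 < s" "s \<le> t" "t < R"
  shows "K s \<le> c * 2 powr p / (1 - 2 powr (p - 1)) * c * (s / t) powr (1 - p) * K t"
proof -
  define B where "B = c * 2 powr p / (1 - 2 powr (p - 1))"
  have "2 powr (p - 1) < (1::real)" using asm by (simp add: powr_less_one)
  then have B: "0 \<le> B" using asm by (simp add: B_def)
  have "K s \<le> B * (s * F s)"
    unfolding B_def by (rule K_le_F_if_F_power_bound[OF F]) (use asm in auto)
  also have "\<dots> \<le> B * (s * (c * (s / t) powr (- p) * F t))"
    using asm B by (intro mult_left_mono F) auto
  also have "\<dots> = B * c * (s / t) powr (1 - p) * (t * F t)"
    using asm by (simp add: powr_diff powr_minus field_simps)
  also have "\<dots> \<le> B * c * (s / t) powr (1 - p) * K t"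
    using K_ge asm B by (intro mult_left_mono) auto
  finally show ?thesis by (simp add: B_def)
qed

end

section \<open>The rearrangement as the optimal height of truncation\<close>

text \<open>
  Only heights \<open>y \<ge> 0\<close> matter. The absolute value of \<open>y\<close> makes the integrand integrable for all \<open>y\<close>, which
  saves a side condition.
\<close>

definition excess :: "(real ^ 'n \<Rightarrow> real) \<Rightarrow> real \<Rightarrow> real" where
  "excess f y = (\<integral>x. max 0 (\<bar>f x\<bar> - \<bar>y\<bar>) \<partial>lebesgue)"

lemma superlevel_measurable:
  fixes f :: "real ^ 'n \<Rightarrow> real"
  assumes "integrable lebesgue f"
  shows "{x. y < \<bar>f x\<bar>} \<in> sets lebesgue"
proof -
  have [measurable]: "f \<in> borel_measurable lebesgue" using assms by auto
  have "{x \<in> space lebesgue. y < \<bar>f x\<bar>} \<in> sets lebesgue" by measurable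
  then show ?thesis by simp
qed

lemma integrable_excess:
  fixes f :: "real ^ 'n \<Rightarrow> real"
  assumes "integrable lebesgue f"
  shows "integrable lebesgue (\<lambda>x. max 0 (\<bar>f x\<bar> - \<bar>y\<bar>))"
  by (rule Bochner_Integration.integrable_bound[OF assms])
     (use assms in auto)

lemma superlevel_emeasure_le:
  fixes f :: "real ^ 'n \<Rightarrow> real"
  assumes "integrable lebesgue f" "0 < y"
  shows "emeasure lebesgue {x. y < \<bar>f x\<bar>} \<le> ennreal ((\<integral>x. \<bar>f x\<bar> \<partial>lebesgue) / y)"
proof -
  have "emeasure lebesgue {x. y < \<bar>f x\<bar>} \<le> emeasure lebesgue {x\<in>space lebesgue. y \<le> \<bar>f x\<bar>}"
  proof (rule emeasure_mono)
    have [measurable]: "f \<in> borel_measurable lebesgue" using assms by auto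
    show "{x \<in> space lebesgue. y \<le> \<bar>f x\<bar>} \<in> sets lebesgue" by measurable
  qed auto
  also have "\<dots> \<le> ennreal (1 / y * (\<integral>x. \<bar>f x\<bar> \<partial>lebesgue))"
    using integral_Markov_inequality[of lebesgue "\<lambda>x. \<bar>f x\<bar>" y] assms by auto
  finally show ?thesis by simp
qed

lemma rearrangement_set_nonempty:
  fixes f :: "real ^ 'n \<Rightarrow> real"
  assumes "integrable lebesgue f" "0 < s"
  shows "{y. 0 \<le> y \<and> emeasure lebesgue {x. y < \<bar>f x\<bar>} \<le> ennreal s} \<noteq> {}"
proof -
  define I where "I = (\<integral>x. \<bar>f x\<bar> \<partial>lebesgue)"
  have I: "0 \<le> I" unfolding I_def by (rule Bochner_Integration.integral_nonneg) simp
  define y where "y = (I + 1) / s"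
  have y: "0 < y" using I assms by (simp add: y_def)
  have "I / y \<le> s" using I assms by (simp add: y_def field_simps)
  then have "emeasure lebesgue {x. y < \<bar>f x\<bar>} \<le> ennreal s"
    using superlevel_emeasure_le[OF assms(1) y] by (fold I_def) (meson ennreal_leI order_trans)
  then show ?thesis using y by (force intro!: exI[of _ y])
qed

lemma rearrangement_nonneg:
  assumes "integrable lebesgue f" "0 < s"
  shows "0 \<le> rearrangement f s"
  unfolding rearrangement_def
  by (rule cInf_greatest[OF rearrangement_set_nonempty[OF assms]]) auto

lemma superlevel_below_rearrangement:
  assumes "0 \<le> y" "y < rearrangement f s"
  shows "ennreal s < emeasure lebesgue {x. y < \<bar>f x\<bar>}"
proof (rule ccontr)
  assume "\<not> ?thesis"
  then have "rearrangement f s \<le> y"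
    unfolding rearrangement_def using assms by (intro cInf_lower bdd_belowI[of _ 0]) auto
  then show False using assms by simp
qed

text \<open>
  The infimum that defines the rearrangement is attained, because the superlevel set at height \<open>z\<close> is the
  increasing union of those at heights \<open>z + 1 / (n + 1)\<close>.
\<close>

lemma superlevel_rearrangement:
  assumes "integrable lebesgue f" "0 < s"
  shows "emeasure lebesgue {x. rearrangement f s < \<bar>f x\<bar>} \<le> ennreal s"
proof -
  define z A where "z = rearrangement f s" and "A = (\<lambda>n. {x. z + 1 / real (Suc n) < \<bar>f x\<bar>})"
  have meas: "A n \<in> sets lebesgue" for n
    unfolding A_def by (rule superlevel_measurable[OF assms(1)])
  have "emeasure lebesgue (A n) \<le> ennreal s" for n
  proof -
    have "z < z + 1 / real (Suc n)" by simp
    then obtain y where y: "0 \<le> y" "emeasure lebesgue {x. y < \<bar>f x\<bar>} \<le> ennreal s"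
        "y < z + 1 / real (Suc n)"
      using cInf_lessD[OF rearrangement_set_nonempty[OF assms]]
      unfolding z_def rearrangement_def by blast
    have "emeasure lebesgue (A n) \<le> emeasure lebesgue {x. y < \<bar>f x\<bar>}"
      using y by (intro emeasure_mono superlevel_measurable assms(1)) (auto simp: A_def)
    then show ?thesis using y by simp
  qed
  moreover have "{x. z < \<bar>f x\<bar>} = (\<Union>n. A n)"
  proof (rule set_eqI)
    fix x
    show "x \<in> {x. z < \<bar>f x\<bar>} \<longleftrightarrow> x \<in> (\<Union>n. A n)"
    proof
      assume "x \<in> {x. z < \<bar>f x\<bar>}"
      then obtain n where "inverse (real (Suc n)) < \<bar>f x\<bar> - z"
        using reals_Archimedean[of "\<bar>f x\<bar> - z"] by auto
      then show "x \<in> (\<Union>n. A n)" 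
        by (auto simp: A_def inverse_eq_divide algebra_simps intro!: exI[of _ n])
    next
      assume "x \<in> (\<Union>n. A n)"
      then obtain n where "z + 1 / real (Suc n) < \<bar>f x\<bar>" by (auto simp: A_def)
      moreover have "0 < 1 / real (Suc n)" by simp
      ultimately show "x \<in> {x. z < \<bar>f x\<bar>}" unfolding mem_Collect_eq by linarith
    qed
  qed
  moreover have "incseq A"
    by (rule incseq_SucI)
       (auto simp: A_def elim!: le_less_trans[rotated] intro!: divide_left_mono)
  then have "(SUP n. emeasure lebesgue (A n)) = emeasure lebesgue (\<Union>n. A n)"
    using meas by (intro SUP_emeasure_incseq) auto
  ultimately show ?thesis
    unfolding z_def[symmetric] by (metis SUP_least)
qed

lemma rearrangement_pos:
  assumes "integrable lebesgue f" "0 < s" "ennreal s < emeasure lebesgue {x. f x \<noteq> 0}"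
  shows "0 < rearrangement f s"
proof (rule ccontr)
  assume "\<not> ?thesis"
  then have "rearrangement f s = 0"
    using rearrangement_nonneg[OF assms(1,2)] by simp
  then show False
    using superlevel_rearrangement[OF assms(1,2)] assms(3) by simp
qed

text \<open>
  The convex function \<open>excess f\<close> has slope \<open>- |{y < |f|}|\<close> at \<open>y\<close>. Comparing the integrands pointwise
  bounds its decrease on \<open>[y, z]\<close> by the slopes at the two ends, without differentiating.
\<close>

lemma excess_diff:
  assumes f: "integrable lebesgue f" and "0 \<le> y" "y \<le> z"
  shows "emeasure lebesgue {x. y < \<bar>f x\<bar>} < \<infinity> \<Longrightarrow>
      excess f y \<le> excess f z + (z - y) * measure lebesgue {x. y < \<bar>f x\<bar>}"
    and "0 < z \<Longrightarrow> excess f z + (z - y) * measure lebesgue {x. z < \<bar>f x\<bar>} \<le> excess f y"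
proof -
  have fin: "emeasure lebesgue {x. u < \<bar>f x\<bar>} < \<infinity>" if "0 < u" for u
    using superlevel_emeasure_le[OF f that] by (simp add: le_less_trans)
  have meas: "{x. u < \<bar>f x\<bar>} \<in> sets lebesgue" for u
    by (rule superlevel_measurable[OF f])
  have step: "integrable lebesgue (\<lambda>x. (z - y) * indicator {x. u < \<bar>f x\<bar>} x)"
      and step_integral: "(\<integral>x. max 0 (\<bar>f x\<bar> - \<bar>z\<bar>) + (z - y) * indicator {x. u < \<bar>f x\<bar>} x \<partial>lebesgue)
        = excess f z + (z - y) * measure lebesgue {x. u < \<bar>f x\<bar>}"
    if "emeasure lebesgue {x. u < \<bar>f x\<bar>} < \<infinity>" for u
  proof -
    show int: "integrable lebesgue (\<lambda>x. (z - y) * indicator {x. u < \<bar>f x\<bar>} x)"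
      using that meas[of u] by (intro integrable_mult_right) auto
    show "(\<integral>x. max 0 (\<bar>f x\<bar> - \<bar>z\<bar>) + (z - y) * indicator {x. u < \<bar>f x\<bar>} x \<partial>lebesgue)
        = excess f z + (z - y) * measure lebesgue {x. u < \<bar>f x\<bar>}"
      using integrable_excess[OF f, of z] int
      by (simp add: excess_def)
  qed
  show "excess f y \<le> excess f z + (z - y) * measure lebesgue {x. y < \<bar>f x\<bar>}"
    if "emeasure lebesgue {x. y < \<bar>f x\<bar>} < \<infinity>"
    unfolding step_integral[OF that, symmetric] unfolding excess_def
    by (intro integral_mono Bochner_Integration.integrable_add integrable_excess f step that)
       (use assms in \<open>auto simp: indicator_def\<close>)
  show "excess f z + (z - y) * measure lebesgue {x. z < \<bar>f x\<bar>} \<le> excess f y" if "0 < z"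
    unfolding step_integral[OF fin[OF that], symmetric] unfolding excess_def
    by (intro integral_mono Bochner_Integration.integrable_add integrable_excess f step fin that)
       (use assms in \<open>auto simp: indicator_def\<close>)
qed

text \<open>
  The function \<open>y \<mapsto> excess f y + s * y\<close> has slope \<open>s - |{y < |f|}|\<close>, which is at most \<open>0\<close>
  to the left of the rearrangement and at least \<open>0\<close> to the right.
\<close>

lemma rearrangement_minimises:
  assumes f: "integrable lebesgue f" and "0 < s" "0 \<le> y"
  shows "excess f (rearrangement f s) + s * rearrangement f s \<le> excess f y + s * y"
proof -
  define r where "r = rearrangement f s"
  have r: "0 \<le> r" "emeasure lebesgue {x. r < \<bar>f x\<bar>} \<le> ennreal s"
    unfolding r_def using rearrangement_nonneg superlevel_rearrangement assms by auto
  show ?thesis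
  proof (cases "r \<le> y")
    case True
    have "excess f r \<le> excess f y + (y - r) * measure lebesgue {x. r < \<bar>f x\<bar>}"
      using r True by (intro excess_diff f) (auto simp: le_less_trans)
    also have "(y - r) * measure lebesgue {x. r < \<bar>f x\<bar>} \<le> (y - r) * s"
      using r(2) assms True by (intro mult_left_mono) (auto simp: measure_def enn2real_leI)
    finally show ?thesis
      by (simp add: r_def[symmetric] algebra_simps)
  next
    case False
    \<comment> \<open>At the height \<open>r\<close> itself the superlevel set may have measure smaller than \<open>s\<close>; so the slope is
      estimated at heights \<open>z < r\<close>, followed by the limit \<open>z \<rightarrow> r\<close>.\<close>
    have below: "excess f r + s * z \<le> excess f y + s * y" if z: "y < z" "z < r" for z
    proof -
      have fin: "emeasure lebesgue {x. z < \<bar>f x\<bar>} < \<infinity>"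
        using superlevel_emeasure_le[OF f, of z] z assms by (simp add: le_less_trans)
      have "ennreal s < emeasure lebesgue {x. z < \<bar>f x\<bar>}"
        using superlevel_below_rearrangement[of z f s] z assms by (simp add: r_def)
      also have "\<dots> = ennreal (measure lebesgue {x. z < \<bar>f x\<bar>})"
        using fin by (intro emeasure_eq_ennreal_measure) auto
      finally have "s \<le> measure lebesgue {x. z < \<bar>f x\<bar>}"
        using assms by (simp add: ennreal_less_iff)
      then have "(z - y) * s \<le> (z - y) * measure lebesgue {x. z < \<bar>f x\<bar>}"
        using z by (intro mult_left_mono) auto
      moreover have "excess f z + (z - y) * measure lebesgue {x. z < \<bar>f x\<bar>} \<le> excess f y"
        using z assms by (intro excess_diff f) auto
      moreover have "excess f r \<le> excess f z"
        unfolding excess_def using z assms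
        by (intro integral_mono integrable_excess f) auto
      ultimately show ?thesis by (simp add: algebra_simps)
    qed
    have "((\<lambda>z. excess f r + s * z) \<longlongrightarrow> excess f r + s * r) (at_left r)"
      by (intro tendsto_intros)
    then have "excess f r + s * r \<le> excess f y + s * y"
    proof (rule tendsto_upperbound)
      show "\<forall>\<^sub>F z in at_left r. excess f r + s * z \<le> excess f y + s * y"
        using False by (intro eventually_at_leftI[of y]) (auto intro: below)
    qed simp
    then show ?thesis by (simp add: r_def)
  qed
qed

lemma excess_tendsto_0:
  fixes f :: "real ^ 'n \<Rightarrow> real"
  assumes f: "integrable lebesgue f"
  shows "(excess f \<longlongrightarrow> 0) at_top"
proof -
  have "((\<lambda>y. \<integral>x. max 0 (\<bar>f x\<bar> - \<bar>y\<bar>) \<partial>lebesgue) \<longlongrightarrow> integral\<^sup>L lebesgue (\<lambda>x::real ^ 'n. 0)) at_top"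
  proof (rule integral_dominated_convergence_at_top[where w = "\<lambda>x. \<bar>f x\<bar>"])
    show "AE x in lebesgue. ((\<lambda>y. max 0 (\<bar>f x\<bar> - \<bar>y\<bar>)) \<longlongrightarrow> 0) at_top"
    proof (rule AE_I2)
      fix x
      have "\<forall>\<^sub>F y in at_top. max 0 (\<bar>f x\<bar> - \<bar>y\<bar>) = 0"
        by (rule eventually_mono[OF eventually_ge_at_top[of "\<bar>f x\<bar>"]]) auto
      then show "((\<lambda>y. max 0 (\<bar>f x\<bar> - \<bar>y\<bar>)) \<longlongrightarrow> 0) at_top"
        by (rule tendsto_eventually)
    qed
  qed (use f in auto)
  then show ?thesis by (simp add: excess_def[abs_def])
qed

section \<open>The K-functional\<close>

text \<open>
  On a null set the essential supremum would be \<open>-\<infinity>\<close>; positive measure of \<open>Q\<close> makes it a real number that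
  bounds \<open>|h|\<close>.
\<close>

lemma Linf_norm_bounds:
  assumes Q: "Q \<in> sets lebesgue" "emeasure lebesgue Q \<noteq> 0" and h: "h \<in> Linf Q"
  shows "0 \<le> Linf_norm Q h" "AE x in lebesgue_on Q. \<bar>h x\<bar> \<le> Linf_norm Q h"
proof -
  define E where "E = esssup (lebesgue_on Q) (\<lambda>x. ereal \<bar>h x\<bar>)"
  have "AE x in lebesgue_on Q. ereal \<bar>h x\<bar> \<le> E"
    unfolding E_def by (rule esssup_AE)
  moreover have "\<bar>h x\<bar> \<le> real_of_ereal E" if "ereal \<bar>h x\<bar> \<le> E" for x
    using that h by (cases E) (auto simp: Linf_def E_def[symmetric])
  ultimately show AE: "AE x in lebesgue_on Q. \<bar>h x\<bar> \<le> Linf_norm Q h"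
    unfolding Linf_norm_def E_def[symmetric] by auto
  have "emeasure (lebesgue_on Q) (space (lebesgue_on Q)) \<noteq> 0"
    using Q by (simp add: emeasure_restrict_space)
  then have "ae_filter (lebesgue_on Q) \<noteq> bot"
    by (simp add: ae_filter_eq_bot_iff)
  then obtain x where "\<bar>h x\<bar> \<le> Linf_norm Q h"
    using eventually_happens'[OF _ AE] by blast
  then show "0 \<le> Linf_norm Q h" by linarith
qed

lemma integral_lebesgue_on_excess:
  assumes "Q \<in> sets lebesgue" "{x. f x \<noteq> 0} \<subseteq> Q"
  shows "(\<integral>x. max 0 (\<bar>f x\<bar> - \<bar>y\<bar>) \<partial>lebesgue_on Q) = excess f y"
proof -
  have "indicat_real Q x *\<^sub>R max 0 (\<bar>f x\<bar> - \<bar>y\<bar>) = max 0 (\<bar>f x\<bar> - \<bar>y\<bar>)" for x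
  proof (cases "x \<in> Q")
    case False
    then have "f x = 0" using assms(2) by auto
    then show ?thesis by simp
  qed simp
  then show ?thesis
    unfolding excess_def using assms(1) by (subst integral_restrict_space) (auto simp del: real_scaleR_def)
qed

text \<open>
  The bounded part absorbs at most its norm from \<open>|f|\<close>, and the integrable part has to account for what
  exceeds this height.
\<close>

lemma decomposition_cost_ge_excess:
  assumes Q: "Q \<in> sets lebesgue" "emeasure lebesgue Q \<noteq> 0"
    and f: "integrable lebesgue f" "{x. f x \<noteq> 0} \<subseteq> Q"
    and g: "g \<in> L1 Q" and h: "h \<in> Linf Q"
    and eq: "AE x in lebesgue_on Q. f x = g x + h x"
  shows "excess f (Linf_norm Q h) \<le> L1_norm Q g"
  unfolding L1_norm_def integral_lebesgue_on_excess[OF Q(1) f(2), symmetric]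
proof (rule integral_mono_AE)
  show "integrable (lebesgue_on Q) (\<lambda>x. max 0 (\<bar>f x\<bar> - \<bar>Linf_norm Q h\<bar>))"
    using Q(1) by (intro integrable_restrict_space[THEN iffD2] integrable_mult_indicator integrable_excess f(1)) auto
  show "integrable (lebesgue_on Q) (\<lambda>x. \<bar>g x\<bar>)"
    using g by (simp add: L1_def)
  show "AE x in lebesgue_on Q. max 0 (\<bar>f x\<bar> - \<bar>Linf_norm Q h\<bar>) \<le> \<bar>g x\<bar>"
    using eq Linf_norm_bounds(2)[OF Q h]
    by eventually_elim (use Linf_norm_bounds(1)[OF Q h] in auto)
qed

lemma truncation_decomposition:
  assumes Q: "Q \<in> sets lebesgue" 
    and f: "integrable lebesgue f" "{x. f x \<noteq> 0} \<subseteq> Q" and "0 \<le> y"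
  obtains g h where "g \<in> L1 Q" "h \<in> Linf Q" "AE x in lebesgue_on Q. f x = g x + h x"
    "L1_norm Q g = excess f y" "Linf_norm Q h \<le> y"
proof
  define g where "g = (\<lambda>x. sgn (f x) * max 0 (\<bar>f x\<bar> - \<bar>y\<bar>))"
  define h where "h = (\<lambda>x. f x - g x)"
  have abs_g: "\<bar>g x\<bar> = max 0 (\<bar>f x\<bar> - \<bar>y\<bar>)" for x
    by (auto simp: g_def abs_mult sgn_if)
  have abs_h: "\<bar>h x\<bar> \<le> y" for x
    using assms(4) by (auto simp: h_def g_def sgn_if max_def)
  have meas: "f \<in> borel_measurable lebesgue" using f by auto
  have meas_g: "g \<in> borel_measurable lebesgue" 
    unfolding g_def using meas by measurable
  have "integrable lebesgue g"
    by (rule Bochner_Integration.integrable_bound[OF integrable_excess[OF f(1), of y] meas_g])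
       (simp add: abs_g)
  then show "g \<in> L1 Q"
    unfolding L1_def mem_Collect_eq using Q
    by (intro integrable_restrict_space[THEN iffD2] integrable_mult_indicator) auto
  have meas_h: "h \<in> borel_measurable (lebesgue_on Q)"
    unfolding h_def using meas meas_g by (intro borel_measurable_diff measurable_restrict_space1)
  have ess: "esssup (lebesgue_on Q) (\<lambda>x. ereal \<bar>h x\<bar>) \<le> ereal y"
    using meas_h abs_h by (intro esssup_I) auto
  then show "h \<in> Linf Q" using meas_h by (auto simp: Linf_def intro: le_less_trans)
  show "Linf_norm Q h \<le> y"
    unfolding Linf_norm_def using ess assms(4)
    by (cases "esssup (lebesgue_on Q) (\<lambda>x. ereal \<bar>h x\<bar>)") auto
  show "AE x in lebesgue_on Q. f x = g x + h x" by (simp add: h_def)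
  show "L1_norm Q g = excess f y"
    unfolding L1_norm_def abs_g by (rule integral_lebesgue_on_excess[OF Q f(2)])
qed

text \<open>
  The two preceding lemmas say that \<open>K_functional s f Q\<close> is the minimum of \<open>excess f y + s * y\<close> over
  \<open>y \<ge> 0\<close>, and the rearrangement is the minimiser.
\<close>

lemma K_functional_eq_rearrangement:
  assumes Q: "Q \<in> sets lebesgue" "emeasure lebesgue Q \<noteq> 0"
    and f: "integrable lebesgue f" "{x. f x \<noteq> 0} \<subseteq> Q" and s: "0 < s"
  shows "K_functional s f Q = excess f (rearrangement f s) + s * rearrangement f s"
  unfolding K_functional_def
proof (rule cInf_eq)
  let ?m = "excess f (rearrangement f s) + s * rearrangement f s"
  show lower: "?m \<le> k"
    if k: "k \<in> {L1_norm Q g + s * Linf_norm Q h | g h.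
      g \<in> L1 Q \<and> h \<in> Linf Q \<and> (AE x in lebesgue_on Q. f x = g x + h x)}" for k
  proof -
    obtain g h where gh: "k = L1_norm Q g + s * Linf_norm Q h" "g \<in> L1 Q" "h \<in> Linf Q"
        "AE x in lebesgue_on Q. f x = g x + h x"
      using k by blast
    have "?m \<le> excess f (Linf_norm Q h) + s * Linf_norm Q h"
      by (rule rearrangement_minimises[OF f(1) s Linf_norm_bounds(1)[OF Q gh(3)]])
    also have "\<dots> \<le> k"
      using decomposition_cost_ge_excess[OF Q f gh(2-4)] gh(1) by simp
    finally show ?thesis .
  qed
  fix b
  assume b: "\<And>k. k \<in> {L1_norm Q g + s * Linf_norm Q h | g h.
      g \<in> L1 Q \<and> h \<in> Linf Q \<and> (AE x in lebesgue_on Q. f x = g x + h x)} \<Longrightarrow> b \<le> k"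
  obtain g h where gh: "g \<in> L1 Q" "h \<in> Linf Q" "AE x in lebesgue_on Q. f x = g x + h x"
    "L1_norm Q g = excess f (rearrangement f s)" "Linf_norm Q h \<le> rearrangement f s"
    by (rule truncation_decomposition[OF Q(1) f rearrangement_nonneg[OF f(1) s]])
  have "b \<le> L1_norm Q g + s * Linf_norm Q h" using gh by (intro b) blast
  also have "\<dots> \<le> ?m" using gh(4,5) s by simp
  finally show "b \<le> ?m" .
qed

lemma truncation_pair_K_functional:
  assumes "Q \<in> sets lebesgue" "emeasure lebesgue Q \<noteq> 0"
    and f: "integrable lebesgue f" and "{x. f x \<noteq> 0} \<subseteq> Q"
  shows "truncation_pair (\<lambda>s. K_functional s f Q) (rearrangement f) (excess f)"
proof
  show "0 \<le> excess f y" for y by (simp add: excess_def)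
  show "(excess f \<longlongrightarrow> 0) at_top" by (rule excess_tendsto_0[OF f])
  fix u y :: real
  assume u: "0 < u"
  show "0 \<le> rearrangement f u" by (rule rearrangement_nonneg[OF f u])
  show K: "K_functional u f Q = excess f (rearrangement f u) + u * rearrangement f u"
    by (rule K_functional_eq_rearrangement[OF assms u])
  show "K_functional u f Q \<le> excess f y + u * y" if "0 \<le> y"
    unfolding K by (rule rearrangement_minimises[OF f u that])
qed

section \<open>Weights on cubes\<close>

lemma cubes_measure:
  assumes "Q \<in> cubes"
  shows "Q \<in> sets lebesgue" "emeasure lebesgue Q = ennreal (measure lebesgue Q)" "0 < measure lebesgue Q"
proof -
  obtain a l where Q: "Q = cbox a (\<chi> i. a $ i + l)" "0 < l"
    using assms unfolding cubes_def by blast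
  show "Q \<in> sets lebesgue" by (simp add: Q)
  show "emeasure lebesgue Q = ennreal (measure lebesgue Q)"
    unfolding Q by (rule emeasure_eq_ennreal_measure) (use emeasure_lborel_cbox_finite in \<open>simp add: less_top\<close>)
  have "a \<bullet> b < (\<chi> i. a $ i + l) \<bullet> b" if "b \<in> Basis" for b
    using that Q(2) by (auto simp: Basis_vec_def inner_axis)
  then show "0 < measure lebesgue Q"
    unfolding Q(1) by (simp add: content_pos_lt_eq)
qed

lemma restr_weight:
  assumes w: "is_weight w" and Q: "Q \<in> cubes"
  shows "integrable lebesgue (restr w Q)"
    and "emeasure lebesgue {x. restr w Q x \<noteq> 0} = emeasure lebesgue Q"
proof -
  have "compact Q" using Q compact_cbox unfolding cubes_def by blast
  then have "w absolutely_integrable_on Q" using w by (simp add: is_weight_def)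
  then show int: "integrable lebesgue (restr w Q)"
    by (simp add: set_integrable_def restr_def mult.commute)
  have "AE x in lebesgue. x \<in> {x. restr w Q x \<noteq> 0} \<longleftrightarrow> x \<in> Q"
    using w unfolding is_weight_def by (auto simp: restr_def indicator_def)
  then show "emeasure lebesgue {x. restr w Q x \<noteq> 0} = emeasure lebesgue Q"
    using superlevel_measurable[OF int, of 0] cubes_measure(1)[OF Q]
    by (intro emeasure_eq_AE) auto
qed

lemma truncation_pair_weight:
  assumes w: "is_weight w" and Q: "Q \<in> cubes"
  shows "truncation_pair (\<lambda>s. K_functional s (restr w Q) Q) (rearrangement (restr w Q)) (excess (restr w Q))"
proof (rule truncation_pair_K_functional)
  show "emeasure lebesgue Q \<noteq> 0"
    unfolding cubes_measure(2)[OF Q] using cubes_measure(3)[OF Q] by simp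
  show "{x. restr w Q x \<noteq> 0} \<subseteq> Q"
    by (auto simp: restr_def indicator_def)
qed (rule cubes_measure(1)[OF Q] restr_weight(1)[OF w Q])+

text \<open>
  This is where positivity of the weight enters: it allows the quotient of rearrangements in
  \<open>ind_tilde\<close> to be multiplied out.
\<close>

lemma rearrangement_weight_pos:
  assumes w: "is_weight w" and Q: "Q \<in> cubes" and "0 < t" "t < measure lebesgue Q"
  shows "0 < rearrangement (restr w Q) t"
proof (rule rearrangement_pos[OF restr_weight(1)[OF w Q] assms(3)])
  show "ennreal t < emeasure lebesgue {x. restr w Q x \<noteq> 0}"
    unfolding restr_weight(2)[OF w Q] cubes_measure(2)[OF Q]
    using assms(3,4) by (simp add: ennreal_less_iff)
qed

section \<open>The two indices\<close>

lemma ind_pos_iff: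
  "0 < ind \<phi> \<longleftrightarrow> (\<exists>\<delta>>0. \<exists>\<gamma>\<in>{0<..<1}. \<exists>C. \<forall>Q\<in>cubes.
     almost_increasing C (\<gamma> * measure lebesgue Q) (\<lambda>s. \<phi> Q s * s powr (- \<delta>)))"
proof -
  have "0 < Sup (ereal ` D) \<longleftrightarrow> (\<exists>\<delta>\<in>D. 0 < \<delta>)" for D
    by (simp add: less_Sup_iff)
  then show ?thesis
    unfolding ind_def by (simp only: mem_Collect_eq Bex_def[of "Collect _"]) (meson less_imp_le)
qed

lemma ind_tilde_less_1_iff:
  "ind_tilde w < 1 \<longleftrightarrow> (\<exists>p>0. p < 1 \<and> (\<exists>r\<in>{0<..<1}. \<exists>c>0. \<forall>Q\<in>cubes. \<forall>s t.
        0 < s \<and> s \<le> t \<and> t < r * measure lebesgue Q \<longrightarrow>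
        rearrangement (restr w Q) s / rearrangement (restr w Q) t \<le> c * (s / t) powr (- p)))"
  unfolding ind_tilde_def Inf_less_iff by (auto simp: one_ereal_def)

lemma almost_increasing_powr_iff:
  assumes "1 \<le> C"
  shows "almost_increasing C l (\<lambda>s. \<phi> s * s powr (- \<delta>)) \<longleftrightarrow>
     (\<forall>s. 0 < s \<and> s < l \<longrightarrow> 0 \<le> \<phi> s) \<and>
     (\<forall>s t. 0 < s \<and> s \<le> t \<and> t < l \<longrightarrow> \<phi> s \<le> C * (s / t) powr \<delta> * \<phi> t)"
proof -
  have 1: "0 \<le> \<phi> s * s powr (- \<delta>) \<longleftrightarrow> 0 \<le> \<phi> s" if "0 < s" for s
    using that by (simp add: zero_le_mult_iff)
  have 2: "\<phi> s * s powr (- \<delta>) \<le> C * (\<phi> t * t powr (- \<delta>)) \<longleftrightarrow> \<phi> s \<le> C * (s / t) powr \<delta> * \<phi> t"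
    if "0 < s" "0 < t" for s t
    using that by (simp add: powr_minus powr_divide field_simps)
  show ?thesis
    unfolding almost_increasing_def using assms 1 2 by fastforce
qed

theorem theorem8:
  fixes w :: "real ^ 'n \<Rightarrow> real"
  assumes "is_weight w"
  shows "ind (\<lambda>Q s. K_functional s (restr w Q) Q) > 0 \<longleftrightarrow> ind_tilde w < 1"
  unfolding ind_pos_iff ind_tilde_less_1_iff
proof
  assume "\<exists>\<delta>>0. \<exists>\<gamma>\<in>{0<..<1}. \<exists>C. \<forall>Q\<in>cubes. almost_increasing C (\<gamma> * measure lebesgue Q)
      (\<lambda>s. K_functional s (restr w Q) Q * s powr (- \<delta>))"
  then obtain \<delta> \<gamma> C where \<delta>: "0 < \<delta>" and \<gamma>: "0 < \<gamma>" "\<gamma> < 1"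
    and "\<forall>Q\<in>cubes. almost_increasing C (\<gamma> * measure lebesgue Q)
      (\<lambda>s. K_functional s (restr w Q) Q * s powr (- \<delta>))"
    by auto
  then have ai: "almost_increasing C (\<gamma> * measure lebesgue Q)
      (\<lambda>s. K_functional s (restr w Q) Q * s powr (- \<delta>))" if "Q \<in> cubes" for Q
    using that by blast
  \<comment> \<open>Any cube yields \<open>C \<ge> 1\<close>, which is part of almost increase.\<close>
  have "cbox 0 (\<chi> i. 0 $ i + 1) \<in> (cubes :: (real ^ 'n) set set)"
    unfolding cubes_def mem_Collect_eq by (rule exI[of _ 0], rule exI[of _ 1]) simp
  from ai[OF this] have C: "1 \<le> C" by (simp add: almost_increasing_def)
  have growth: "K_functional s (restr w Q) Q \<le> C * (s / t) powr \<delta> * K_functional t (restr w Q) Q"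
    if "Q \<in> cubes" "0 < s" "s \<le> t" "t < \<gamma> * measure lebesgue Q" for Q s t
    using ai[OF that(1)] that unfolding almost_increasing_powr_iff[OF C] by blast
  define \<kappa> where "\<kappa> = (1 / (2 * C)) powr (1 / \<delta>)"
  have "\<kappa> < 1 powr (1 / \<delta>)"
    unfolding \<kappa>_def using C \<delta> by (intro powr_less_mono2) auto
  then have \<kappa>: "0 < \<kappa>" "\<kappa> < 1" "C * \<kappa> powr \<delta> \<le> 1 / 2"
    using C \<delta> by (auto simp: \<kappa>_def powr_powr)
  \<comment> \<open>The exponent \<open>1 - \<delta>\<close> may fail to be positive, as \<open>ind_tilde\<close> requires; since \<open>s / t \<le> 1\<close>,
    a larger exponent is a weaker bound.\<close>
  define p where "p = max (1 / 2) (1 - \<delta>)"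
  have "rearrangement (restr w Q) s / rearrangement (restr w Q) t \<le> C / \<kappa> * (s / t) powr (- p)"
    if Q: "Q \<in> cubes" and st: "0 < s" "s \<le> t" "t < \<kappa> * \<gamma> * measure lebesgue Q" for Q s t
  proof -
    interpret truncation_pair "\<lambda>s. K_functional s (restr w Q) Q"
        "rearrangement (restr w Q)" "excess (restr w Q)"
      by (rule truncation_pair_weight[OF assms Q])
    have "rearrangement (restr w Q) s
        \<le> C / \<kappa> * (s / t) powr (\<delta> - 1) * rearrangement (restr w Q) t"
      by (rule F_power_bound_if_K_growth[OF growth[OF Q]]) (use C \<kappa> st in \<open>auto simp: mult_ac\<close>)
    also have "\<dots> \<le> C / \<kappa> * (s / t) powr (- p) * rearrangement (restr w Q) t"
      using st C \<kappa> F_nonneg[of t]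
      by (intro mult_right_mono mult_left_mono powr_mono') (auto simp: p_def)
    finally show ?thesis
      using F_nonneg[of t] st C \<kappa>
      by (cases "rearrangement (restr w Q) t = 0") (auto simp: divide_le_eq)
  qed
  moreover have "0 < p" "p < 1" "0 < C / \<kappa>"
    using \<delta> C \<kappa> by (auto simp: p_def)
  moreover have "\<kappa> * \<gamma> < 1"
    using \<kappa> \<gamma> mult_strict_mono[of \<kappa> 1 \<gamma> 1] by simp
  then have "\<kappa> * \<gamma> \<in> {0<..<1}"
    using \<kappa> \<gamma> by simp
  ultimately show "\<exists>p>0. p < 1 \<and> (\<exists>r\<in>{0<..<1}. \<exists>c>0. \<forall>Q\<in>cubes. \<forall>s t.
        0 < s \<and> s \<le> t \<and> t < r * measure lebesgue Q \<longrightarrow>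
        rearrangement (restr w Q) s / rearrangement (restr w Q) t \<le> c * (s / t) powr (- p))"
    by blast
next
  assume "\<exists>p>0. p < 1 \<and> (\<exists>r\<in>{0<..<1}. \<exists>c>0. \<forall>Q\<in>cubes. \<forall>s t.
        0 < s \<and> s \<le> t \<and> t < r * measure lebesgue Q \<longrightarrow>
        rearrangement (restr w Q) s / rearrangement (restr w Q) t \<le> c * (s / t) powr (- p))"
  then obtain p r c where p: "0 < p" "p < 1" and r: "0 < r" "r < 1" and c: "0 < c"
    and ratio: "\<And>Q s t. \<lbrakk>Q \<in> cubes; 0 < s; s \<le> t; t < r * measure lebesgue Q\<rbrakk> \<Longrightarrow>
        rearrangement (restr w Q) s / rearrangement (restr w Q) t \<le> c * (s / t) powr (- p)"
    by auto
  have bound: "rearrangement (restr w Q) s \<le> c * (s / t) powr (- p) * rearrangement (restr w Q) t"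
    if "Q \<in> cubes" "0 < s" "s \<le> t" "t < r * measure lebesgue Q" for Q s t
  proof -
    have "r * measure lebesgue Q \<le> measure lebesgue Q"
      using r cubes_measure(3)[OF that(1)] by (simp add: mult_le_cancel_right1)
    then have "0 < rearrangement (restr w Q) t"
      using that by (intro rearrangement_weight_pos assms) auto
    then show ?thesis using ratio[OF that] by (simp add: divide_le_eq)
  qed
  define C where "C = c * 2 powr p / (1 - 2 powr (p - 1)) * c"
  have "almost_increasing (max 1 C) (r * measure lebesgue Q)
      (\<lambda>s. K_functional s (restr w Q) Q * s powr (- (1 - p)))" if Q: "Q \<in> cubes" for Q
  proof -
    interpret truncation_pair "\<lambda>s. K_functional s (restr w Q) Q"
        "rearrangement (restr w Q)" "excess (restr w Q)"
      by (rule truncation_pair_weight[OF assms Q])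
    have "K_functional s (restr w Q) Q
        \<le> max 1 C * (s / t) powr (1 - p) * K_functional t (restr w Q) Q"
      if st: "0 < s" "s \<le> t" "t < r * measure lebesgue Q" for s t
    proof -
      have "K_functional s (restr w Q) Q \<le> C * (s / t) powr (1 - p) * K_functional t (restr w Q) Q"
        unfolding C_def by (rule K_growth_if_F_power_bound[OF bound[OF Q]]) (use st p c in auto)
      also have "\<dots> \<le> max 1 C * (s / t) powr (1 - p) * K_functional t (restr w Q) Q"
        using K_nonneg[of t] st by (intro mult_right_mono) auto
      finally show ?thesis .
    qed
    then show ?thesis
      using K_nonneg by (subst almost_increasing_powr_iff) auto
  qed
  then show "\<exists>\<delta>>0. \<exists>\<gamma>\<in>{0<..<1}. \<exists>C. \<forall>Q\<in>cubes. almost_increasing C (\<gamma> * measure lebesgue Q)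
      (\<lambda>s. K_functional s (restr w Q) Q * s powr (- \<delta>))"
    using p r by (intro exI[of _ "1 - p"] bexI[of _ r] exI[of _ "max 1 C"] conjI) auto
qed

end
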